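(* For integers $n\ge k\ge 0$, in $\hat{\mathbb Q}(\mathbf t)$, $$\mathbf H_{n-k}(1,t,\ldots,t^k)=\left[\begin{matrix} n\\k\end{matrix}\right]_{q,t}.$$
   Context: $\hat{\mathbb Q}(\mathbf t)$ is the field of rational functions over $\mathbb Q$ in algebraically independent indeterminates denoted $t^{q^r}$, $r\in\mathbb Z$ ($t=t^{q^0}$; $q$ is a formal symbol); $t^{q^r-q^s}$ denotes the quotient $t^{q^r}/t^{q^s}$. For a partition $\lambda=(\lambda_1\ge\cdots\ge\lambda_N\ge0)$, in $N$ variables, $\mathbf S_\lambda(x_1,\ldots,x_N):=\det\big(x_i^{q^{\lambda_j+N-j}}\big)_{i,j=1}^N\big/\det\big(x_i^{q^{N-j}}\big)_{i,j=1}^N$, where the $x_i^{q^r}$ ($1\le i\le N$, $r\in\mathbb Z$) are algebraically independent indeterminates. The principal specialization $\mathbf S_\lambda(1,t,\ldots,t^{N-1})\in\hat{\mathbb Q}(\mathbf t)$ is obtained by substituting $x_i^{q^r}\mapsto (t^{q^r})^{i-1}$ in numerator and denominator (the denominator becomes a nonzero Vandermonde determinant). Set $\mathbf H_r:=\mathbf S_{(r)}=\mathbf S_{(r,0,\ldots,0)}$ for $r\ge0$. In the claim, $N=k+1$. $(q,t)$-binomial: $\left[\begin{smallmatrix} n\\k\end{smallmatrix}\right]_{q,t}:=\prod_{i=1}^k\frac{1-t^{q^n-q^{i-1}}}{1-t^{q^k-q^{i-1}}}$. *)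

theory Defs
  imports
    "HOL-Library.Poly_Mapping"
    "HOL-Library.Product_Lexorder"
    "HOL-Computational_Algebra.Fraction_Field"
    "HOL-Computational_Algebra.Polynomial_Factorial"
    "Jordan_Normal_Form.Determinant"
begin

section \<open>Rational functions over the rationals in arbitrarily many indeterminates\<close>

text \<open>
  A linear order on the index type \<open>'v\<close> is needed only so that the library's instances make
  the polynomial ring an integral domain; this is also why the lexicographic order on pairs
  is imported.
\<close>

type_synonym 'v qpoly = "('v \<Rightarrow>\<^sub>0 nat) \<Rightarrow>\<^sub>0 rat"
type_synonym 'v qratfun = "'v qpoly fract"

definition qconst :: "rat \<Rightarrow> 'v qpoly" where
  "qconst c = Poly_Mapping.single 0 c"

definition qvar :: "'v \<Rightarrow> 'v qpoly" where
  "qvar v = Poly_Mapping.single (Poly_Mapping.single v 1) 1"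

definition qpoly_subst :: "('v \<Rightarrow> 'w qpoly) \<Rightarrow> 'v qpoly \<Rightarrow> 'w qpoly" where
  "qpoly_subst \<sigma> p =
     (\<Sum>m \<in> Poly_Mapping.keys p. qconst (Poly_Mapping.lookup p m) * (\<Prod>v \<in> Poly_Mapping.keys m. \<sigma> v ^ Poly_Mapping.lookup m v))"

text \<open>
  A substitution is applied to a rational function by substituting in the numerator and the
  denominator of a representation whose denominator does not vanish under the substitution.
  The lemma \<open>qratfun_subst_Fract\<close> below shows that the result does not depend on the
  representation. If there is no such representation, the value is unspecified.
\<close>

definition qratfun_subst ::
    "('v::linorder \<Rightarrow> ('w::linorder) qpoly) \<Rightarrow> 'v qratfun \<Rightarrow> 'w qratfun" where
  "qratfun_subst \<sigma> f =
     (THE g. \<exists>a b. f = Fract a b \<and> qpoly_subst \<sigma> b \<noteq> 0 \<and>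
                   g = Fract (qpoly_subst \<sigma> a) (qpoly_subst \<sigma> b))"

lemma qconst_simps [simp]:
  "qconst 0 = 0" "qconst 1 = 1"
  "qconst (a + b) = qconst a + qconst b" "qconst (a * b) = qconst a * qconst b"
  by (simp_all add: qconst_def single_add mult_single)

lemma qpoly_subst_superset:
  assumes "finite A" "Poly_Mapping.keys p \<subseteq> A"
  shows "qpoly_subst \<sigma> p =
    (\<Sum>m \<in> A. qconst (Poly_Mapping.lookup p m) * (\<Prod>v \<in> Poly_Mapping.keys m. \<sigma> v ^ Poly_Mapping.lookup m v))"
  unfolding qpoly_subst_def
  by (rule sum.mono_neutral_left) (use assms in \<open>auto simp: in_keys_iff\<close>)

lemma qpoly_subst_0 [simp]: "qpoly_subst \<sigma> 0 = 0"
  by (simp add: qpoly_subst_def)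

lemma qpoly_subst_single:
  "qpoly_subst \<sigma> (Poly_Mapping.single m c) =
     qconst c * (\<Prod>v \<in> Poly_Mapping.keys m. \<sigma> v ^ Poly_Mapping.lookup m v)"
  by (subst qpoly_subst_superset[of "{m}"]) auto

lemma qpoly_subst_1 [simp]: "qpoly_subst \<sigma> 1 = 1"
  using qpoly_subst_single[of \<sigma> 0 1] by simp

lemma qpoly_subst_qvar [simp]: "qpoly_subst \<sigma> (qvar v) = \<sigma> v"
  by (simp add: qvar_def qpoly_subst_single)

lemma qpoly_subst_add: "qpoly_subst \<sigma> (p + q) = qpoly_subst \<sigma> p + qpoly_subst \<sigma> q"
proof -
  let ?A = "Poly_Mapping.keys p \<union> Poly_Mapping.keys q"
  have "Poly_Mapping.keys (p + q) \<subseteq> ?A" by (rule keys_add)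
  then show ?thesis
    by (simp add: qpoly_subst_superset[of ?A] lookup_add distrib_right sum.distrib)
qed

lemma qpoly_subst_monom_mult:
  "(\<Prod>v \<in> Poly_Mapping.keys (m + m'). \<sigma> v ^ Poly_Mapping.lookup (m + m') v) =
   (\<Prod>v \<in> Poly_Mapping.keys m. \<sigma> v ^ Poly_Mapping.lookup m v) * (\<Prod>v \<in> Poly_Mapping.keys m'. (\<sigma> v :: 'w qpoly) ^ Poly_Mapping.lookup m' v)"
proof -
  let ?A = "Poly_Mapping.keys m \<union> Poly_Mapping.keys m'"
  have expand: "(\<Prod>v \<in> Poly_Mapping.keys k. \<sigma> v ^ Poly_Mapping.lookup k v) = (\<Prod>v \<in> ?A. \<sigma> v ^ Poly_Mapping.lookup k v)"
    if "Poly_Mapping.keys k \<subseteq> ?A" for k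
    by (rule prod.mono_neutral_left) (use that in \<open>auto simp: in_keys_iff\<close>)
  have "Poly_Mapping.keys (m + m') \<subseteq> ?A" by (rule keys_add)
  then show ?thesis
    unfolding expand[OF Un_upper1] expand[OF Un_upper2]
    by (subst expand) (simp_all add: lookup_add power_add prod.distrib)
qed

lemma qpoly_induct [case_names zero add]:
  fixes p :: "'v qpoly"
  assumes "P 0" and "\<And>f m c. P f \<Longrightarrow> P (Poly_Mapping.single m c + f)"
  shows "P p"
proof (induction p rule: update_induct)
  case (update f m c)
  have "Poly_Mapping.update m c f = Poly_Mapping.single m c + f"
    using update(1)
    by (intro poly_mapping_eqI) (auto simp: lookup_update lookup_add lookup_single in_keys_iff)
  then show ?case using assms(2)[OF update(3)] by simp
qed (rule assms(1))

lemma qpoly_subst_mult: "qpoly_subst \<sigma> (p * q) = qpoly_subst \<sigma> p * qpoly_subst \<sigma> q"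
proof (induction p rule: qpoly_induct)
  case (add f m c)
  have "qpoly_subst \<sigma> (Poly_Mapping.single m c * q) =
        qpoly_subst \<sigma> (Poly_Mapping.single m c) * qpoly_subst \<sigma> q"
  proof (induction q rule: qpoly_induct)
    case (add g m' c')
    have "qpoly_subst \<sigma> (Poly_Mapping.single m c * Poly_Mapping.single m' c') =
          qpoly_subst \<sigma> (Poly_Mapping.single m c) * qpoly_subst \<sigma> (Poly_Mapping.single m' c')"
      by (simp only: mult_single qpoly_subst_single qpoly_subst_monom_mult qconst_simps ac_simps)
    with add show ?case by (simp add: distrib_left qpoly_subst_add)
  qed simp
  with add show ?case by (simp add: distrib_right qpoly_subst_add)
qed simp

lemma qratfun_subst_Fract:
  assumes "qpoly_subst \<sigma> b \<noteq> 0"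
  shows "qratfun_subst \<sigma> (Fract a b) = Fract (qpoly_subst \<sigma> a) (qpoly_subst \<sigma> b)"
  unfolding qratfun_subst_def
proof (rule the_equality)
  fix g
  assume "\<exists>c d. Fract a b = Fract c d \<and> qpoly_subst \<sigma> d \<noteq> 0 \<and>
                g = Fract (qpoly_subst \<sigma> c) (qpoly_subst \<sigma> d)"
  then obtain c d where cd: "Fract a b = Fract c d" "qpoly_subst \<sigma> d \<noteq> 0"
    "g = Fract (qpoly_subst \<sigma> c) (qpoly_subst \<sigma> d)" by blast
  have "b \<noteq> 0" "d \<noteq> 0" using assms cd(2) by auto
  with cd(1) have "qpoly_subst \<sigma> (a * d) = qpoly_subst \<sigma> (c * b)" by (simp add: eq_fract)
  then show "g = Fract (qpoly_subst \<sigma> a) (qpoly_subst \<sigma> b)"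
    using assms cd(2,3) by (simp add: eq_fract qpoly_subst_mult)
qed (use assms in blast)

section \<open>The functions \<open>S\<^sub>\<lambda>\<close> and \<open>H\<^sub>r\<close>, and their principal specialization\<close>

text \<open>
  The indeterminate with index \<open>(i, r)\<close> is \<open>x\<^sub>i\<close> raised to the formal exponent \<open>q\<^sup>r\<close>, with
  \<open>i\<close> counted from 1. A partition in \<open>N\<close> variables is a list of length \<open>N\<close>, including
  trailing zeros. Matrix and list indices start at 0, whence the shifts by one.
\<close>

definition S_num :: "nat list \<Rightarrow> (nat \<times> int) qpoly" where
  "S_num \<mu> = (let N = length \<mu> in
     det (mat N N (\<lambda>(i, j). qvar (Suc i, int (\<mu> ! j) + int N - int (Suc j)))))"

definition S_den :: "nat \<Rightarrow> (nat \<times> int) qpoly" where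
  "S_den N = det (mat N N (\<lambda>(i, j). qvar (Suc i, int N - int (Suc j))))"

definition S_fun :: "nat list \<Rightarrow> (nat \<times> int) qratfun" where
  "S_fun \<mu> = Fract (S_num \<mu>) (S_den (length \<mu>))"

definition H_fun :: "nat \<Rightarrow> nat \<Rightarrow> (nat \<times> int) qratfun" where
  "H_fun N r = S_fun (r # replicate (N - 1) 0)"

text \<open>
  The field \<^typ>\<open>int qratfun\<close> is the target: its indeterminate with index \<open>r\<close> is \<open>t\<close> raised
  to the formal exponent \<open>q\<^sup>r\<close>.
\<close>

definition principal_spec :: "(nat \<times> int) qratfun \<Rightarrow> int qratfun" where
  "principal_spec = qratfun_subst (\<lambda>(i, r). qvar r ^ (i - 1))"

definition t_pow :: "int \<Rightarrow> int qratfun" where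
  "t_pow r = to_fract (qvar r)"

definition t_pow_diff :: "int \<Rightarrow> int \<Rightarrow> int qratfun" where
  "t_pow_diff r s = t_pow r / t_pow s"

definition qt_binomial :: "nat \<Rightarrow> nat \<Rightarrow> int qratfun" where
  "qt_binomial n k =
     (\<Prod>i = 1..k. (1 - t_pow_diff (int n) (int i - 1)) / (1 - t_pow_diff (int k) (int i - 1)))"

end

theory Submission
  imports Defs
begin

text \<open>
  Write \<open>T\<^sub>r\<close> for the indeterminate \<open>t\<close> with formal exponent \<open>q\<^sup>r\<close>. After the principal
  specialization row \<open>i\<close> of either determinant, counted from 0, consists of \<open>i\<close>-th powers, so
  both are Vandermonde determinants of size \<open>k + 1\<close>. For the one-row partition
  \<open>(n - k, 0, \<dots>, 0)\<close> the nodes are \<open>T\<^sub>n, T\<^bsub>k-1\<^esub>, \<dots>, T\<^sub>0\<close> in the numerator and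
  \<open>T\<^sub>k, T\<^bsub>k-1\<^esub>, \<dots>, T\<^sub>0\<close> in the denominator: the two matrices share all columns but the first.

  As a function of the node \<open>z\<close> of its first column, such a determinant is a polynomial of
  degree at most \<open>k\<close> that vanishes at the other \<open>k\<close> nodes, which are distinct. Hence it is the
  product of the \<open>z - T\<^sub>i\<close> for \<open>0 \<le> i < k\<close> with a factor that does not depend on \<open>z\<close>
  (\<open>det_vandermonde_first_node\<close>). This factor is up to sign the smaller Vandermonde determinant
  of the shared nodes, so it is nonzero (\<open>det_vandermonde_nonzero\<close>) and cancels in the
  quotient. What remains is the product of the \<open>(T\<^sub>n - T\<^sub>i) / (T\<^sub>k - T\<^sub>i)\<close>; dividing the numerator
  and the denominator of each factor by \<open>- T\<^sub>i\<close> gives the \<open>(q,t)\<close>-binomial.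
\<close>

definition vandermonde :: "nat \<Rightarrow> (nat \<Rightarrow> 'a :: comm_ring_1) \<Rightarrow> 'a mat" where
  "vandermonde n y = mat n n (\<lambda>(i, j). y j ^ i)"

lemma vandermonde_carrier [simp]: "vandermonde n y \<in> carrier_mat n n"
  by (simp add: vandermonde_def)

lemma vandermonde_cong:
  assumes "\<And>j. j < n \<Longrightarrow> y j = z j"
  shows "vandermonde n y = vandermonde n z"
  using assms by (auto simp: vandermonde_def)

text \<open>
  The difference of the two sides has at least \<open>k\<close> roots and degree at most \<open>k\<close>. If it were
  nonzero its degree would be exactly \<open>k\<close>, but its coefficient of degree \<open>k\<close> is zero.
\<close>

lemma poly_eq_top_coeff_times_linear_factors:
  fixes p :: "'a :: idom poly"
  assumes deg: "degree p \<le> k" and inj: "inj_on y {..<k}"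
    and roots: "\<And>j. j < k \<Longrightarrow> poly p (y j) = 0"
  shows "p = smult (coeff p k) (\<Prod>j<k. [:- y j, 1:])"
proof (rule ccontr)
  define f where "f = (\<Prod>j<k. [:- y j, 1:])"
  define r where "r = p - smult (coeff p k) f"
  assume "p \<noteq> smult (coeff p k) (\<Prod>j<k. [:- y j, 1:])"
  then have r0: "r \<noteq> 0" by (simp add: r_def f_def)
  have degf: "degree f = k"
    unfolding f_def by (subst degree_prod_eq_sum_degree) auto
  have "lead_coeff f = 1"
    unfolding f_def by (simp add: lead_coeff_prod)
  with degf have "coeff f k = 1" by simp
  then have top: "coeff r k = 0" by (simp add: r_def)
  have "degree r \<le> k"
    unfolding r_def using deg degf degree_smult_le[of "coeff p k" f]
    by (intro degree_diff_le) auto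
  moreover have "y ` {..<k} \<subseteq> {x. poly r x = 0}"
    using roots by (auto simp: r_def f_def poly_prod)
  then have "card (y ` {..<k}) \<le> card {x. poly r x = 0}"
    using poly_roots_finite[OF r0] by (intro card_mono)
  then have "k \<le> degree r"
    using card_image[OF inj] card_poly_roots_bound[OF r0] by simp
  ultimately have "degree r = k" by simp
  with top r0 show False by (metis leading_coeff_0_iff)
qed

text \<open>
  Expanding along the first column exhibits the determinant as the value at \<open>z\<close> of a polynomial
  whose coefficients are cofactors, which do not involve \<open>z\<close>; the top one is, up to sign, the
  Vandermonde determinant of the remaining nodes. Two equal columns give the roots.
\<close>

lemma det_vandermonde_first_node:
  fixes y :: "nat \<Rightarrow> 'a :: idom"
  assumes inj: "inj_on y {..<k}"
  shows "det (vandermonde (Suc k) (case_nat z y)) =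
    (- 1) ^ k * det (vandermonde k y) * (\<Prod>j<k. z - y j)"
proof -
  let ?V = "\<lambda>z. vandermonde (Suc k) (case_nat z y)"
  define c where "c i = cofactor (?V 0) i 0" for i
  define p where "p = (\<Sum>i<Suc k. monom (c i) i)"
  have cofactor: "cofactor (?V x) i 0 = c i" for x i
  proof -
    have "mat_delete (?V x) i 0 = mat_delete (?V 0) i 0"
      by (rule eq_matI) (auto simp: mat_delete_def vandermonde_def)
    then show ?thesis by (simp add: c_def cofactor_def)
  qed
  have det_eq: "det (?V x) = poly p x" for x
  proof -
    have "det (?V x) = (\<Sum>i<Suc k. ?V x $$ (i, 0) * cofactor (?V x) i 0)"
      by (rule laplace_expansion_column) auto
    also have "\<dots> = (\<Sum>i<Suc k. c i * x ^ i)"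
      unfolding cofactor by (rule sum.cong) (auto simp: vandermonde_def)
    finally show ?thesis by (simp add: p_def poly_sum poly_monom)
  qed
  have top: "coeff p k = (- 1) ^ k * det (vandermonde k y)"
  proof -
    have "mat_delete (?V 0) k 0 = vandermonde k y"
      by (rule eq_matI) (auto simp: mat_delete_def vandermonde_def)
    then have "c k = (- 1) ^ k * det (vandermonde k y)"
      by (simp add: c_def cofactor_def)
    then show ?thesis by (simp add: p_def coeff_sum coeff_monom)
  qed
  have deg: "degree p \<le> k"
    unfolding p_def by (intro degree_sum_le) (auto intro: order_trans[OF degree_monom_le])
  have roots: "poly p (y j) = 0" if "j < k" for j
  proof -
    have "col (?V (y j)) 0 = col (?V (y j)) (Suc j)"
      using that by (intro eq_vecI) (auto simp: vandermonde_def)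
    then have "det (?V (y j)) = 0"
      using that by (intro det_identical_columns[of _ "Suc k" 0 "Suc j"]) auto
    then show ?thesis by (simp add: det_eq)
  qed
  have "poly p z = poly (smult (coeff p k) (\<Prod>j<k. [:- y j, 1:])) z"
    using poly_eq_top_coeff_times_linear_factors[OF deg inj roots] by (rule arg_cong)
  then show ?thesis
    by (simp add: det_eq top poly_prod)
qed

lemma det_vandermonde_nonzero:
  fixes y :: "nat \<Rightarrow> 'a :: idom"
  assumes "inj_on y {..<k}"
  shows "det (vandermonde k y) \<noteq> 0"
  using assms
proof (induction k arbitrary: y)
  case 0
  then show ?case by (simp add: vandermonde_def)
next
  case (Suc k)
  let ?y = "\<lambda>j. y (Suc j)"
  have inj: "inj_on ?y {..<k}"
    using Suc.prems by (auto simp: inj_on_def)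
  have "y 0 \<noteq> ?y j" if "j < k" for j
    using Suc.prems that by (auto dest: inj_onD)
  moreover have "case_nat (y 0) ?y = y"
    by (auto split: nat.split)
  ultimately show ?case
    using det_vandermonde_first_node[OF inj, of "y 0"] Suc.IH[OF inj] by simp
qed

lemma qvar_eq_iff [simp]: "qvar v = qvar w \<longleftrightarrow> v = w"
proof
  assume "qvar v = qvar w"
  then have "Poly_Mapping.keys (qvar v) = Poly_Mapping.keys (qvar w)" by simp
  then have "Poly_Mapping.single v (1 :: nat) = Poly_Mapping.single w 1"
    by (simp add: qvar_def)
  then have "Poly_Mapping.keys (Poly_Mapping.single v (1 :: nat)) =
      Poly_Mapping.keys (Poly_Mapping.single w (1 :: nat))"
    by simp
  then show "v = w" by simp
qed simp

lemma qvar_nonzero [simp]: "qvar v \<noteq> 0"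
  by (simp add: qvar_def flip: keys_eq_empty)

lemma comm_ring_hom_qpoly_subst: "comm_ring_hom (qpoly_subst \<sigma>)"
  by unfold_locales (simp_all add: qpoly_subst_add qpoly_subst_mult)

text \<open>
  Variables are counted from 1 and rows from 0, so the variable in row \<open>i\<close> is sent to the
  power with exponent \<open>(i + 1) - 1 = i\<close>.
\<close>

lemma qpoly_subst_det_qvar:
  "qpoly_subst (\<lambda>(i, r). qvar r ^ (i - 1)) (det (mat N N (\<lambda>(i, j). qvar (Suc i, e j)))) =
    det (vandermonde N (\<lambda>j. qvar (e j)))"
proof -
  let ?\<sigma> = "\<lambda>(i :: nat, r). qvar r ^ (i - 1)"
  interpret comm_ring_hom "qpoly_subst ?\<sigma>"
    by (rule comm_ring_hom_qpoly_subst)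
  have "map_mat (qpoly_subst ?\<sigma>) (mat N N (\<lambda>(i, j). qvar (Suc i, e j))) =
      vandermonde N (\<lambda>j. qvar (e j))"
    by (rule eq_matI) (auto simp: vandermonde_def)
  then show ?thesis by (metis hom_det)
qed

lemma to_fract_prod: "to_fract (\<Prod>i\<in>A. f i) = (\<Prod>i\<in>A. to_fract (f i))"
  by (induction A rule: infinite_finite_induct) auto

theorem theorem6p2:
  fixes n k :: nat
  assumes "k \<le> n"
  shows "principal_spec (H_fun (k + 1) (n - k)) = qt_binomial n k"
proof -
  let ?\<sigma> = "\<lambda>(i :: nat, r :: int). qvar r ^ (i - 1)"
  let ?\<mu> = "(n - k) # replicate k 0"
  define y :: "nat \<Rightarrow> int qpoly" where "y j = qvar (int k - int (Suc j))" for j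
  define c where "c = (- 1) ^ k * det (vandermonde k y)"
  have inj: "inj_on y {..<k}"
    by (auto simp: inj_on_def y_def)
  have num: "qpoly_subst ?\<sigma> (S_num ?\<mu>) = c * (\<Prod>j<k. qvar (int n) - y j)"
  proof -
    have "qpoly_subst ?\<sigma> (S_num ?\<mu>) = det (vandermonde (Suc k) (case_nat (qvar (int n)) y))"
      unfolding S_num_def Let_def qpoly_subst_det_qvar
      using assms by (auto intro!: arg_cong[of _ _ det] vandermonde_cong
        simp: y_def of_nat_diff split: nat.split)
    then show ?thesis by (simp add: det_vandermonde_first_node[OF inj] c_def)
  qed
  have den: "qpoly_subst ?\<sigma> (S_den (Suc k)) = c * (\<Prod>j<k. qvar (int k) - y j)"
  proof -
    have "qpoly_subst ?\<sigma> (S_den (Suc k)) = det (vandermonde (Suc k) (case_nat (qvar (int k)) y))"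
      unfolding S_den_def qpoly_subst_det_qvar
      by (auto intro!: arg_cong[of _ _ det] vandermonde_cong simp: y_def split: nat.split)
    then show ?thesis by (simp add: det_vandermonde_first_node[OF inj] c_def)
  qed
  have c: "c \<noteq> 0"
    using det_vandermonde_nonzero[OF inj] by (simp add: c_def)
  have den_nz: "(\<Prod>j<k. qvar (int k) - y j) \<noteq> 0"
    by (simp add: y_def)
  have "principal_spec (H_fun (k + 1) (n - k)) =
      Fract (c * (\<Prod>j<k. qvar (int n) - y j)) (c * (\<Prod>j<k. qvar (int k) - y j))"
    using qratfun_subst_Fract[of ?\<sigma> "S_den (Suc k)" "S_num ?\<mu>"] c den_nz
    unfolding num den by (simp add: principal_spec_def H_fun_def S_fun_def)
  also have "\<dots> = Fract (\<Prod>j<k. qvar (int n) - y j) (\<Prod>j<k. qvar (int k) - y j)"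
    using c by (rule mult_fract_cancel)
  also have "\<dots> = (\<Prod>j<k. (t_pow (int n) - to_fract (y j)) / (t_pow (int k) - to_fract (y j)))"
    by (simp add: Fract_conv_to_fract to_fract_prod t_pow_def prod_dividef)
  also have "\<dots> = (\<Prod>i<k. (t_pow (int n) - t_pow (int i)) / (t_pow (int k) - t_pow (int i)))"
    \<comment> \<open>The columns list the shared nodes in decreasing order of the exponent.\<close>
    by (subst prod.nat_diff_reindex[symmetric])
      (auto intro!: prod.cong simp: y_def t_pow_def of_nat_diff)
  also have "\<dots> = (\<Prod>i<k. (1 - t_pow_diff (int n) (int i)) / (1 - t_pow_diff (int k) (int i)))"
  proof (rule prod.cong)
    fix i assume "i \<in> {..<k}"
    have cancel: "(a - b) / (d - b) = (1 - a / b) / (1 - d / b)"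
      if "b \<noteq> 0" for a b d :: "int qratfun"
    proof -
      have "1 - x / b = (b - x) / b" for x
        using that by (simp add: diff_divide_distrib)
      then have "(1 - a / b) / (1 - d / b) = (b - a) / (b - d)"
        using that by simp
      also have "\<dots> = (a - b) / (d - b)"
        using minus_divide_divide[of "a - b" "d - b"] by simp
      finally show ?thesis ..
    qed
    show "(t_pow (int n) - t_pow (int i)) / (t_pow (int k) - t_pow (int i)) =
        (1 - t_pow_diff (int n) (int i)) / (1 - t_pow_diff (int k) (int i))"
      unfolding t_pow_diff_def by (rule cancel) (simp add: t_pow_def)
  qed simp
  also have "\<dots> = qt_binomial n k"
    unfolding qt_binomial_def
    by (rule prod.reindex_bij_witness[of _ "\<lambda>i. i - 1" Suc]) auto
  finally show ?thesis .
qed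

end
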